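(* Assume that $\mathrm{cov}(\mathcal{N})=\mathfrak{b}=\mathfrak{c}$. Then there exists a set $X\subseteq 2^\omega\times 2^\omega$ with the following properties: (1) $X$ is Hurewicz; (2) $X$ is a $\lambda'$-set (in $2^\omega\times 2^\omega$); (3) $X$ is totally imperfect; (4) $\pi[X]=2^\omega$, where $\pi\colon 2^\omega\times 2^\omega\to 2^\omega$ is the projection onto the first coordinate; (5) there is a homeomorphic copy of $X$ in $2^\omega$ which is not perfectly meager in the transitive sense (PMT).
   Context: $2^\omega$ is the Cantor space with the usual product topology. $\mathfrak{c}$ is the cardinality of the continuum; $\mathfrak{b}$ is the bounding number, i.e. the minimal cardinality of a subset of $\omega^\omega$ that is unbounded with respect to eventual domination $\le^*$; $\mathrm{cov}(\mathcal{N})$ is the minimal cardinality of a family of Lebesgue-null subsets of $2^\omega$ which covers $2^\omega$. A set $X$ is Hurewicz if for every sequence $\mathcal{U}_0,\mathcal{U}_1,\dots$ of open covers of $X$ there are finite sets $\mathcal{F}_0\subseteq\mathcal{U}_0,\mathcal{F}_1\subseteq\mathcal{U}_1,\dots$ such that for every $x\in X$ the set $\{n\in\omega: x\in\bigcup\mathcal{F}_n\}$ is cofinite. A subset $X$ of a topological space is a $\lambda'$-set if for every countable subset $A$ of the space, $A$ is a $G_\delta$-set in the relative topology of $X\cup A$. A perfect set is a homeomorphic copy of $2^\omega$. A set is totally imperfect if it contains no perfect subset. For $x,y\in 2^\omega$, $(x\oplus y)(n):=(x(n)+y(n))\bmod 2$ for all $n$; for $t\in 2^\omega$ and $A\subseteq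 2^\omega$, $t\oplus A:=\{t\oplus a: a\in A\}$. A set $Y\subseteq 2^\omega$ is perfectly meager in the transitive sense (PMT) if for every perfect set $P\subseteq 2^\omega$ there is a $\sigma$-compact set $F\subseteq 2^\omega$ containing $Y$ such that for all $t\in 2^\omega$ the set $F\cap(t\oplus P)$ is meager in the relative topology of $t\oplus P$. *)

theory Defs
  imports "HOL-Probability.Probability"
begin

unbundle cardinal_syntax

(* The topology is the product topology given by the type class instance for functions,
   with bool discrete; False and True play the roles of 0 and 1. *)
type_synonym cantor = "nat \<Rightarrow> bool"

text \<open>Cardinals are represented, up to \<open>=o\<close>, by cardinal well-orders. Provided that some set
  satisfies \<open>P\<close>, \<open>min_card P\<close> is the least cardinality of such a set; see \<open>min_card\<close> below.\<close>

definition min_card :: "('a set \<Rightarrow> bool) \<Rightarrow> 'a rel" where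
  "min_card P = |SOME A. P A \<and> (\<forall>B. P B \<longrightarrow> |A| \<le>o |B| )|"

lemma min_card:
  assumes "P A0"
  shows "\<exists>A. P A \<and> min_card P = |A|" and "P B \<Longrightarrow> min_card P \<le>o |B|"
proof -
  have "\<exists>r \<in> card_of ` Collect P. \<forall>r' \<in> card_of ` Collect P. r \<le>o r'"
    by (rule exists_minim_Card_order) (use assms card_of_Card_order in auto)
  then have "\<exists>A. P A \<and> (\<forall>B. P B \<longrightarrow> |A| \<le>o |B| )"
    by auto
  from someI_ex[OF this] show "\<exists>A. P A \<and> min_card P = |A|" and "P B \<Longrightarrow> min_card P \<le>o |B|"
    unfolding min_card_def by blast+
qed

definition eventually_dominated :: "(nat \<Rightarrow> nat) \<Rightarrow> (nat \<Rightarrow> nat) \<Rightarrow> bool" (infix \<open>\<le>\<^sup>*\<close> 50) where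
  "f \<le>\<^sup>* g \<longleftrightarrow> (\<forall>\<^sub>F n in sequentially. f n \<le> g n)"

definition unbounded :: "(nat \<Rightarrow> nat) set \<Rightarrow> bool" where
  "unbounded B \<longleftrightarrow> \<not> (\<exists>g. \<forall>f \<in> B. f \<le>\<^sup>* g)"

definition bounding_number :: "(nat \<Rightarrow> nat) rel" where
  "bounding_number = min_card unbounded"

definition cantor_measure :: "cantor measure" where
  "cantor_measure = completion (PiM UNIV (\<lambda>_. measure_pmf (bernoulli_pmf (1/2))))"

definition null_cover :: "cantor set set \<Rightarrow> bool" where
  "null_cover F \<longleftrightarrow> F \<subseteq> null_sets cantor_measure \<and> \<Union>F = UNIV"

definition cov_null :: "cantor set rel" where
  "cov_null = min_card null_cover"

definition continuum :: "real rel" where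
  "continuum = |UNIV :: real set|"

definition Hurewicz :: "'a::topological_space set \<Rightarrow> bool" where
  "Hurewicz X \<longleftrightarrow>
    (\<forall>\<U> :: nat \<Rightarrow> 'a set set.
      (\<forall>n. (\<forall>U \<in> \<U> n. openin (top_of_set X) U) \<and> \<Union>(\<U> n) = X) \<longrightarrow>
      (\<exists>\<F>. (\<forall>n. finite (\<F> n) \<and> \<F> n \<subseteq> \<U> n) \<and>
           (\<forall>x \<in> X. finite (- {n. x \<in> \<Union>(\<F> n)}))))"

definition lambda'_set :: "'a::topological_space set \<Rightarrow> bool" where
  "lambda'_set X \<longleftrightarrow> (\<forall>A. countable A \<longrightarrow> gdelta_in (top_of_set (X \<union> A)) A)"

definition perfect_set :: "'a::topological_space set \<Rightarrow> bool" where
  "perfect_set P \<longleftrightarrow> P homeomorphic (UNIV :: cantor set)"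

definition totally_imperfect :: "'a::topological_space set \<Rightarrow> bool" where
  "totally_imperfect X \<longleftrightarrow> \<not> (\<exists>P \<subseteq> X. perfect_set P)"

definition nowhere_dense_in :: "'a topology \<Rightarrow> 'a set \<Rightarrow> bool" where
  "nowhere_dense_in T N \<longleftrightarrow> N \<subseteq> topspace T \<and> T interior_of (T closure_of N) = {}"

definition meager_in :: "'a topology \<Rightarrow> 'a set \<Rightarrow> bool" where
  "meager_in T \<equiv> countable union_of nowhere_dense_in T"

definition sigma_compact :: "'a::topological_space set \<Rightarrow> bool" where
  "sigma_compact \<equiv> countable union_of compact"

(* addition mod 2 on bool is exclusive or, i.e. inequality *)
definition oplus :: "cantor \<Rightarrow> cantor \<Rightarrow> cantor" (infixl \<open>\<oplus>\<^sub>2\<close> 65) where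
  "x \<oplus>\<^sub>2 y = (\<lambda>n. x n \<noteq> y n)"

definition PMT :: "cantor set \<Rightarrow> bool" where
  "PMT Y \<longleftrightarrow>
    (\<forall>P. perfect_set P \<longrightarrow>
      (\<exists>F. sigma_compact F \<and> Y \<subseteq> F \<and>
        (\<forall>t. meager_in (top_of_set ((\<oplus>\<^sub>2) t ` P)) (F \<inter> (\<oplus>\<^sub>2) t ` P))))"

end

theory Submission
  imports Defs
begin

text \<open>Choose, for every \<open>G\<^sub>\<delta>\<close> subset of the plane whose second projection contains a measurable set of
  positive measure, a point of it, in such a way that every null set contains the second coordinates
  of fewer than continuum many of the chosen points; this is possible because, by the zero-one law,
  a set of positive measure is not covered by fewer than \<open>cov(\<N>)\<close> null sets. Let \<open>X\<close> be the set of these points. Given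
  increasing open covers \<open>W n k\<close> of \<open>X\<close> (\<open>k = 0, 1, \<dots>\<close>), the second projection of the
  complement of their union is null, since \<open>X\<close> misses this closed set. By compactness,
  for a suitable \<open>k n\<close> the sets \<open>W n (k n)\<close> contain all but a small set of the horizontal lines, hence
  by Borel-Cantelli almost every line is in all but finitely many of them. The fewer than
  \<open>\<bb>\<close> remaining points of \<open>X\<close> are handled by domination, and so \<open>X\<close> is Hurewicz. In the same way, a
  null \<open>G\<^sub>\<delta>\<close> set containing the second coordinates of a countable set reduces the \<open>\<lambda>'\<close> property to
  sets with fewer than \<open>\<bb>\<close> points. A \<open>\<lambda>'\<close>-set contains no perfect set, because a countable dense
  set is not \<open>G\<^sub>\<delta>\<close> in a perfect set. Finally, interleave the coordinates; the horizontal lines become the translates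
  of one perfect set \<open>P\<close>. A \<open>\<sigma>\<close>-compact set that is meager on all these translates misses a
  point of every line, so its complement contains a point of \<open>X\<close>.\<close>

subsection \<open>The coin-tossing measure\<close>

text \<open>These instances make \<open>cantor\<close> a Polish space, so that outer regularity and the Baire category
  theorem of the library apply; the topology of \<open>bool\<close> is unchanged.\<close>

instantiation bool :: metric_space
begin

definition dist_bool :: "bool \<Rightarrow> bool \<Rightarrow> real" where
  "dist_bool x y = of_bool (x \<noteq> y)"

definition uniformity_bool :: "(bool \<times> bool) filter" where
  "uniformity_bool = (INF e\<in>{0<..}. principal {(x, y). dist x y < e})"

instance
proof
  fix U :: "bool set"
  have "\<forall>x\<in>U. \<forall>\<^sub>F (x', y) in uniformity. x' = x \<longrightarrow> y \<in> U"
    unfolding uniformity_bool_def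
    by (intro ballI eventually_INF1[of "1/2"]) (auto simp: eventually_principal dist_bool_def)
  then show "open U = (\<forall>x\<in>U. \<forall>\<^sub>F (x', y) in uniformity. x' = x \<longrightarrow> y \<in> U)"
    by (simp add: discrete_topology_class.open_discrete)
qed (auto simp: uniformity_bool_def dist_bool_def)

end

lemma eq_of_dist_bool_less: "dist x y < 1 / 2 \<Longrightarrow> x = y" for x y :: bool
  by (cases x; cases y) (simp_all add: dist_bool_def)

instance bool :: complete_space
proof
  fix X :: "nat \<Rightarrow> bool" assume "Cauchy X"
  then obtain M where "\<forall>m\<ge>M. \<forall>n\<ge>M. dist (X m) (X n) < 1/2"
    by (metis Cauchy_def half_gt_zero zero_less_one)
  then have *: "dist (X n) (X M) < 1/2" if "n \<ge> M" for n
    using that by blast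
  have "X n = X M" if "n \<ge> M" for n
    by (rule eq_of_dist_bool_less) (rule *[OF that])
  then have "X \<longlonglongrightarrow> X M"
    by (intro tendsto_eventually eventually_sequentiallyI[of M])
  then show "convergent X" by (rule convergentI)
qed

instance bool :: second_countable_topology
proof
  show "\<exists>B::bool set set. countable B \<and> open = generate_topology B"
  proof (intro exI conjI ext iffI)
    show "countable (UNIV :: bool set set)" by (rule countable_finite) simp
  qed (auto simp: discrete_topology_class.open_discrete intro: generate_topology.Basis)
qed

instance bool :: polish_space ..

section \<open>Fair coin tossing and its invariance under translation\<close>

abbreviation coin :: "bool measure" where
  "coin \<equiv> measure_pmf (bernoulli_pmf (1/2))"

text \<open>The uncompleted form of \<open>cantor_measure\<close>, with exactly the Borel sets as
  measurable sets.\<close>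

abbreviation coins :: "cantor measure" where
  "coins \<equiv> PiM UNIV (\<lambda>_. coin)"

lemma sets_coins: "sets coins = sets borel"
proof -
  have "sets coins = sets (PiM UNIV (\<lambda>_::nat. borel :: bool measure))"
    by (rule sets_PiM_cong) (auto simp: sets_borel_eq_count_space)
  then show ?thesis
    using sets_PiM_equal_borel by metis
qed

lemma space_coins: "space coins = UNIV"
  by (simp add: space_PiM)

interpretation coins: product_prob_space "\<lambda>_::nat. coin" UNIV
  by unfold_locales

lemma continuous_on_oplus: "continuous_on UNIV ((\<oplus>\<^sub>2) t)"
proof -
  have "continuous_on UNIV (\<lambda>x::cantor. t n \<noteq> x n)" for n
    by (rule continuous_on_compose2[of UNIV "\<lambda>b. t n \<noteq> b" UNIV "\<lambda>x. x n"])
       (auto intro!: continuous_on_product_coordinates continuous_on_discrete)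
  then show ?thesis
    unfolding oplus_def by (intro continuous_on_coordinatewise_then_product) auto
qed

lemma measurable_oplus: "(\<oplus>\<^sub>2) t \<in> coins \<rightarrow>\<^sub>M coins"
  using borel_measurable_continuous_onI[OF continuous_on_oplus]
  by (simp add: measurable_cong_sets[OF sets_coins sets_coins])

lemma bool_set_cases: "A = {} \<or> A = {True} \<or> A = {False} \<or> A = (UNIV :: bool set)"
proof -
  have "A \<in> Pow {False, True}"
    unfolding UNIV_bool[symmetric] Pow_UNIV by (rule UNIV_I)
  then have "A = {} \<or> A = {True} \<or> A = {False} \<or> A = {False, True}"
    unfolding Pow_insert Pow_empty by blast
  then show ?thesis
    unfolding UNIV_bool .
qed

lemma measure_coin_flip: "measure coin ((\<lambda>x. c \<noteq> x) -` A) = measure coin A"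
proof -
  have *: "(\<lambda>x. c \<noteq> x) -` {b} = {c \<noteq> b}" for b
    by (rule set_eqI, rename_tac x, case_tac x; cases b; cases c) simp_all
  have 1: "measure coin {b} = 1 / 2" for b
    by (cases b) (simp_all add: measure_pmf_single)
  show ?thesis
    using bool_set_cases[of A]
  proof (elim disjE)
    assume "A = {True}" then show ?thesis by (simp only: * 1)
  next
    assume "A = {False}" then show ?thesis by (simp only: * 1)
  qed simp_all
qed

lemma prod_emb_box:
  "prod_emb UNIV (\<lambda>_::nat. coin) J (Pi\<^sub>E J F) = {x. \<forall>j\<in>J. x j \<in> F j}"
  by (auto simp: prod_emb_def space_PiM restrict_PiE_iff)

lemma box_in_sets: "finite J \<Longrightarrow> {x. \<forall>j\<in>J. x j \<in> F j} \<in> sets coins"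
  unfolding prod_emb_box[symmetric] by (rule sets_PiM_I) auto

lemma measure_coins_box:
  "finite J \<Longrightarrow> measure coins {x. \<forall>j\<in>J. x j \<in> F j} = (\<Prod>j\<in>J. measure coin (F j))"
  unfolding prod_emb_box[symmetric] by (rule coins.measure_PiM_emb) auto

lemma measure_eq_coinsI:
  assumes "prob_space \<nu>" "sets \<nu> = sets coins"
    and "\<And>J F. finite J \<Longrightarrow>
      measure \<nu> {x. \<forall>j\<in>J. x j \<in> F j} = (\<Prod>j\<in>J. measure coin (F j))"
  shows "\<nu> = coins"
proof (rule coins.PiM_eq)
  interpret prob_space \<nu> by fact
  fix J :: "nat set" and F :: "nat \<Rightarrow> bool set"
  assume "finite J"
  then show "emeasure \<nu> (prod_emb UNIV (\<lambda>_. coin) J (Pi\<^sub>E J F)) = (\<Prod>j\<in>J. emeasure coin (F j))"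
    by (simp add: prod_emb_box emeasure_eq_measure measure_pmf.emeasure_eq_measure assms(3)
        prod_ennreal)
qed (fact assms(2))

text \<open>Each coordinate is kept or negated, and a fair coin is symmetric, so every box keeps its
  measure.\<close>

lemma distr_oplus_coins: "distr coins coins ((\<oplus>\<^sub>2) t) = coins"
proof (rule measure_eq_coinsI)
  show "prob_space (distr coins coins ((\<oplus>\<^sub>2) t))"
    by (rule coins.prob_space_distr[OF measurable_oplus])
  fix J :: "nat set" and F :: "nat \<Rightarrow> bool set"
  assume J: "finite J"
  have "measure (distr coins coins ((\<oplus>\<^sub>2) t)) {x. \<forall>j\<in>J. x j \<in> F j}
      = measure coins {x. \<forall>j\<in>J. x j \<in> (\<lambda>x. t j \<noteq> x) -` F j}"
    by (subst measure_distr[OF measurable_oplus box_in_sets[OF J]])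
       (auto simp: space_coins oplus_def vimage_def)
  then show "measure (distr coins coins ((\<oplus>\<^sub>2) t)) {x. \<forall>j\<in>J. x j \<in> F j}
      = (\<Prod>j\<in>J. measure coin (F j))"
    by (simp only: measure_coins_box[OF J] measure_coin_flip)
qed auto

lemma oplus_oplus [simp]: "t \<oplus>\<^sub>2 (t \<oplus>\<^sub>2 x) = x"
  by (auto simp: oplus_def)

text \<open>Translation is an involution; measurability and measure of translates thus reduce to
  preimages.\<close>

lemma oplus_image: "(\<oplus>\<^sub>2) t ` A = (\<oplus>\<^sub>2) t -` A"
  by (force simp: image_iff)

lemma oplus_image_sets: "A \<in> sets coins \<Longrightarrow> (\<oplus>\<^sub>2) t ` A \<in> sets coins"
  using measurable_sets[OF measurable_oplus] by (simp add: oplus_image space_coins)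

lemma emeasure_oplus_image: "A \<in> sets coins \<Longrightarrow> emeasure coins ((\<oplus>\<^sub>2) t ` A) = emeasure coins A"
  using emeasure_distr[OF measurable_oplus, of A t]
  by (simp add: distr_oplus_coins oplus_image space_coins)

text \<open>Flipping one coordinate halves every box, which determines the measure.\<close>

lemma flip_invariant_measure_eq_coins:
  assumes "prob_space \<nu>" "sets \<nu> = sets coins"
    and flip: "\<And>j A. A \<in> sets coins \<Longrightarrow> measure \<nu> ((\<oplus>\<^sub>2) (\<lambda>i. i = j) ` A) = measure \<nu> A"
  shows "\<nu> = coins"
proof (rule measure_eq_coinsI)
  interpret prob_space \<nu> by fact
  have sp: "space \<nu> = UNIV" using sets_eq_imp_space_eq[OF assms(2)] by (simp add: space_coins)
  fix J :: "nat set" and F :: "nat \<Rightarrow> bool set"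
  assume "finite J"
  then show "measure \<nu> {x. \<forall>j\<in>J. x j \<in> F j} = (\<Prod>j\<in>J. measure coin (F j))"
  proof induction
    case empty
    show ?case using prob_space sp by simp
  next
    case (insert j J)
    define A where "A = {x. \<forall>i\<in>J. x i \<in> F i}"
    define B where "B b = A \<inter> {x. x j = b}" for b
    have A: "A \<in> sets coins" unfolding A_def by (rule box_in_sets) fact
    have B: "B b \<in> sets coins" for b
      using A box_in_sets[of "{j}" "\<lambda>_. {b}"] unfolding B_def by auto
    have "B False = (\<oplus>\<^sub>2) (\<lambda>i. i = j) ` B True"
    proof -
      \<comment> \<open>Here \<open>j\<close> is not in \<open>J\<close>, so flipping coordinate
        \<open>j\<close> does not affect membership in \<open>A\<close>.\<close>
      have "(i = j) = (\<not> x i) \<longleftrightarrow> x i" if "i \<in> J" for i and x :: cantor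
        using that insert(2) by blast
      then show ?thesis
        unfolding oplus_image B_def A_def by (auto simp: oplus_def)
    qed
    then have eq: "measure \<nu> (B False) = measure \<nu> (B True)"
      using flip[OF B] by simp
    have "measure \<nu> A = measure \<nu> (B True \<union> B False)"
      by (rule arg_cong[where f = "measure \<nu>"]) (auto simp: B_def)
    also have "\<dots> = measure \<nu> (B True) + measure \<nu> (B False)"
      by (rule finite_measure_Union) (use B assms(2) in \<open>simp_all, auto simp: B_def\<close>)
    finally have half: "measure \<nu> (B b) = measure \<nu> A / 2" for b
      using eq by (cases b) auto
    have box: "{x. \<forall>i\<in>insert j J. x i \<in> F i} = A \<inter> {x. x j \<in> F j}"
      by (auto simp: A_def)
    have IH: "measure \<nu> A = (\<Prod>j\<in>J. measure coin (F j))"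
      using insert by (simp add: A_def)
    have "measure \<nu> (A \<inter> {x. x j \<in> F j}) = measure coin (F j) * measure \<nu> A"
      using bool_set_cases[of "F j"]
    proof (elim disjE)
      assume *: "F j = {True}"
      have "A \<inter> {x. x j \<in> F j} = B True" unfolding * B_def by simp
      then show ?thesis using * by (simp add: half measure_pmf_single)
    next
      assume *: "F j = {False}"
      have "A \<inter> {x. x j \<in> F j} = B False" unfolding * B_def by simp
      then show ?thesis using * by (simp add: half measure_pmf_single)
    qed simp_all
    then show ?case
      unfolding box using insert(1,2) by (simp add: IH)
  qed
qed (fact assms(1,2))+

section \<open>The zero-one law for finitely supported translations\<close>

lemma countable_finite_support: "countable {t::cantor. finite {n. t n}}"
proof (rule countable_image_inj_on)
  show "countable ((\<lambda>t. {n. t n}) ` {t::cantor. finite {n. t n}})"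
    by (rule countable_subset[OF _ countable_Collect_finite]) auto
qed (auto simp: inj_on_def)

text \<open>The union \<open>T\<close> of the translates is invariant under flipping any coordinate.
  Conditioning \<open>coins\<close> on \<open>T\<close> yields a flip-invariant probability measure,
  hence \<open>coins\<close> itself; but the conditioned measure vanishes on the complement of
  \<open>T\<close>.\<close>

lemma zero_one_law_coins:
  assumes B: "B \<in> sets coins" "emeasure coins B \<noteq> 0"
  shows "- (\<Union>t\<in>{t. finite {n. t n}}. (\<oplus>\<^sub>2) t ` B) \<in> null_sets coins"
proof -
  define T where "T = (\<Union>t\<in>{t. finite {n. t n}}. (\<oplus>\<^sub>2) t ` B)"
  have T: "T \<in> sets coins"
    unfolding T_def using countable_finite_support oplus_image_sets[OF B(1)]
    by (intro sets.countable_UN'') auto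
  have nT: "- T \<in> sets coins"
    using sets.compl_sets[OF T] by (metis space_coins Compl_eq_Diff_UNIV)
  have "(\<oplus>\<^sub>2) (\<lambda>_. False) = id" by (simp add: fun_eq_iff oplus_def)
  moreover have "(\<oplus>\<^sub>2) (\<lambda>_. False) ` B \<subseteq> T" unfolding T_def by (rule UN_upper) simp
  ultimately have "B \<subseteq> T" by simp
  then have pos: "emeasure coins T \<noteq> 0"
    using B T emeasure_mono[of B T coins] by auto
  have inv: "(\<oplus>\<^sub>2) (\<lambda>i. i = j) ` T \<subseteq> T" for j
  proof
    fix y assume "y \<in> (\<oplus>\<^sub>2) (\<lambda>i. i = j) ` T"
    then obtain t b where t: "finite {n. t n}" "b \<in> B" "y = (\<lambda>i. i = j) \<oplus>\<^sub>2 (t \<oplus>\<^sub>2 b)"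
      by (auto simp: T_def)
    then have "y = ((\<lambda>i. i = j) \<oplus>\<^sub>2 t) \<oplus>\<^sub>2 b" by (auto simp: oplus_def)
    moreover have "finite {n. ((\<lambda>i. i = j) \<oplus>\<^sub>2 t) n}"
      by (rule finite_subset[of _ "insert j {n. t n}"]) (use t in \<open>auto simp: oplus_def\<close>)
    ultimately show "y \<in> T" using t by (auto simp: T_def)
  qed
  have inv_eq: "(\<oplus>\<^sub>2) (\<lambda>i. i = j) ` T = T" for j
    using inv[of j] image_mono[OF inv[of j], of "(\<oplus>\<^sub>2) (\<lambda>i. i = j)"]
    by (auto simp: image_image)
  have prob: "prob_space (uniform_measure coins T)"
    by (rule prob_space_uniform_measure) (use pos in auto)
  have "uniform_measure coins T = coins"
  proof (rule flip_invariant_measure_eq_coins)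
    fix j and A :: "cantor set" assume A: "A \<in> sets coins"
    have "T \<inter> (\<oplus>\<^sub>2) (\<lambda>i. i = j) ` A = (\<oplus>\<^sub>2) (\<lambda>i. i = j) ` (T \<inter> A)"
      by (subst (1) inv_eq[of j, symmetric]) (auto simp: oplus_image)
    then show "measure (uniform_measure coins T) ((\<oplus>\<^sub>2) (\<lambda>i. i = j) ` A)
        = measure (uniform_measure coins T) A"
      using T A by (simp add: measure_def oplus_image_sets emeasure_oplus_image)
  qed (use prob in auto)
  then have "emeasure coins (- T) = emeasure (uniform_measure coins T) (- T)"
    by simp
  also have "\<dots> = 0"
    using T nT by simp
  finally have "emeasure coins (- T) = 0" .
  with nT show ?thesis
    unfolding T_def by (rule null_setsI[rotated])
qed

subsection \<open>Construction of the set\<close>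

lemma ordLess_real_if_countable:
  assumes "countable A" shows "|A| <o |UNIV :: real set|"
proof -
  obtain f :: "'a \<Rightarrow> nat" where "inj_on f A"
    using assms by (auto simp: countable_def)
  then have "|A| \<le>o |UNIV :: nat set|"
    by (intro card_of_ordLeq[THEN iffD1] exI[of _ f]) simp
  moreover have "|UNIV :: nat set| <o |UNIV :: real set|"
  proof (rule ccontr)
    assume "\<not> |UNIV :: nat set| <o |UNIV :: real set|"
    then have "|UNIV :: real set| \<le>o |UNIV :: nat set|"
      unfolding not_ordLess_iff_ordLeq[OF card_of_Well_order card_of_Well_order] .
    then have "\<exists>g :: real \<Rightarrow> nat. inj g \<and> range g \<subseteq> UNIV"
      unfolding card_of_ordLeq .
    then obtain g :: "real \<Rightarrow> nat" where "inj g" by blast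
    then have "countable (UNIV :: real set)" by (rule countableI)
    then show False using uncountable_UNIV_real by blast
  qed
  ultimately show ?thesis by (rule ordLeq_ordLess_trans)
qed

text \<open>An infinite \<open>F\<close> absorbs the countable factor; a finite one leaves a
  countable product.\<close>

lemma ordLess_real_Times_countable:
  assumes "countable D" "|F| <o |UNIV :: real set|"
  shows "|D \<times> F| <o |UNIV :: real set|"
proof (cases "finite F \<or> D = {}")
  case True
  then have "countable (D \<times> F)"
    using assms(1) by (metis countable_SIGMA countable_empty countable_finite Sigma_empty1)
  then show ?thesis by (rule ordLess_real_if_countable)
next
  case False
  obtain f :: "'a \<Rightarrow> nat" where "inj_on f D"
    using assms by (auto simp: countable_def)
  then have "|D| \<le>o |UNIV :: nat set|"
    by (intro card_of_ordLeq[THEN iffD1] exI[of _ f]) simp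
  also have "|UNIV :: nat set| \<le>o |F|"
    using False infinite_iff_card_of_nat[of F] by simp
  finally have "|D \<times> F| =o |F|"
    using False by (intro card_of_Times_infinite_simps(3)) simp_all
  then show ?thesis using assms(2) by (rule ordIso_ordLess_trans)
qed

lemma oplus_null_sets:
  assumes "N \<in> null_sets cantor_measure"
  shows "(\<oplus>\<^sub>2) t ` N \<in> null_sets cantor_measure"
proof -
  obtain N' where N': "N' \<in> null_sets coins" "N \<subseteq> N'"
    using assms unfolding cantor_measure_def null_sets_completion_iff2 by blast
  then have "(\<oplus>\<^sub>2) t ` N' \<in> null_sets coins"
    by (auto simp: null_sets_def oplus_image_sets emeasure_oplus_image)
  moreover have "(\<oplus>\<^sub>2) t ` N \<subseteq> (\<oplus>\<^sub>2) t ` N'"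
    using N'(2) by (rule image_mono)
  ultimately show ?thesis
    unfolding cantor_measure_def null_sets_completion_iff2 by blast
qed

text \<open>If \<open>F\<close> covered \<open>B\<close>, its finitely supported translates,
  together with the null set left over by the zero-one law, would be a null cover with fewer than
  continuum many members.\<close>

lemma positive_measure_not_covered:
  assumes cov: "|UNIV :: real set| \<le>o cov_null"
    and B: "B \<in> sets coins" "emeasure coins B \<noteq> 0"
    and F: "F \<subseteq> null_sets cantor_measure" "|F| <o |UNIV :: real set|"
  shows "\<not> B \<subseteq> \<Union>F"
proof
  assume BF: "B \<subseteq> \<Union>F"
  define D :: "cantor set" where "D = {t. finite {n. t n}}"
  define G where "G = (\<lambda>(t, N). (\<oplus>\<^sub>2) t ` N) ` (D \<times> F) \<union> {- (\<Union>t\<in>D. (\<oplus>\<^sub>2) t ` B)}"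
  have "- (\<Union>t\<in>D. (\<oplus>\<^sub>2) t ` B) \<in> null_sets cantor_measure"
    unfolding D_def cantor_measure_def
    by (intro null_sets_completionI zero_one_law_coins B)
  then have "G \<subseteq> null_sets cantor_measure"
    using F(1) oplus_null_sets by (auto simp: G_def)
  moreover have "x \<in> \<Union>G" for x
  proof (cases "\<exists>t\<in>D. x \<in> (\<oplus>\<^sub>2) t ` B")
    case True
    then obtain t b where t: "t \<in> D" "b \<in> B" "x = t \<oplus>\<^sub>2 b" by blast
    then obtain N where "N \<in> F" "b \<in> N" using BF by blast
    with t have "(\<oplus>\<^sub>2) t ` N \<in> G" "x \<in> (\<oplus>\<^sub>2) t ` N" by (auto simp: G_def)
    then show ?thesis by blast
  qed (auto simp: G_def)
  ultimately have "null_cover G" by (auto simp: null_cover_def)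
  then have "cov_null \<le>o |G|"
    unfolding cov_null_def by (rule min_card(2)[rotated])  fact
  with cov have "|UNIV :: real set| \<le>o |G|" by (rule ordLeq_transitive)
  moreover have "|G| <o |UNIV :: real set|"
    unfolding G_def
  proof (rule card_of_Un_ordLess_infinite)
    show "|(\<lambda>(t, N). (\<oplus>\<^sub>2) t ` N) ` (D \<times> F)| <o |UNIV :: real set|"
      using card_of_image
        ordLess_real_Times_countable[OF countable_finite_support[folded D_def] F(2)]
      by (rule ordLeq_ordLess_trans)
  qed (auto simp: infinite_UNIV_char_0 intro: ordLess_real_if_countable)
  ultimately show False using not_ordLess_ordLeq by blast
qed

section \<open>G-delta sets and their enumeration by reals\<close>

lemma gdelta_in_euclidean:
  fixes G :: "'a::topological_space set"
  shows "gdelta_in euclidean G \<longleftrightarrow> (\<exists>C :: nat \<Rightarrow> 'a set. (\<forall>n. open (C n)) \<and> G = (\<Inter>n. C n))"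
proof
  assume "gdelta_in euclidean G"
  then obtain C :: "nat \<Rightarrow> 'a set" where "\<forall>n. openin euclidean (C n)" "(\<Inter>n. C n) = G"
    unfolding gdelta_in_descending by (elim exE conjE)
  then show "\<exists>C :: nat \<Rightarrow> 'a set. (\<forall>n. open (C n)) \<and> G = (\<Inter>n. C n)"
    by (intro exI[of _ C]) (simp flip: open_openin)
next
  assume "\<exists>C :: nat \<Rightarrow> 'a set. (\<forall>n. open (C n)) \<and> G = (\<Inter>n. C n)"
  then obtain C :: "nat \<Rightarrow> 'a set" where C: "\<forall>n. open (C n)" "G = (\<Inter>n. C n)"
    by (elim exE conjE)
  show "gdelta_in euclidean G"
    unfolding C(2) using C(1) by (intro gdelta_in_Inter) (auto intro!: open_imp_gdelta_in)
qed

text \<open>Outer regularity of a Borel null superset. It allows all null sets to be handled through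
  G-delta ones, which can be indexed by reals.\<close>

lemma null_gdelta_superset:
  assumes "N \<in> null_sets cantor_measure"
  obtains G where "N \<subseteq> G" "gdelta_in euclidean G" "G \<in> null_sets coins"
proof -
  obtain N' where N': "N' \<in> null_sets coins" "N \<subseteq> N'"
    using assms unfolding cantor_measure_def null_sets_completion_iff2 by blast
  have "\<exists>U. open U \<and> N' \<subseteq> U \<and> emeasure coins U < ennreal (1 / Suc n)" for n
  proof -
    have "(INF U \<in> {U. N' \<subseteq> U \<and> open U}. emeasure coins U) = emeasure coins N'"
      by (rule outer_regular[symmetric]) (use N' sets_coins in auto)
    also have "\<dots> < ennreal (1 / Suc n)" by (simp add: null_setsD1[OF N'(1)])
    finally show ?thesis by (auto simp: INF_less_iff)
  qed
  then obtain U where U: "\<And>n. open (U n)" "\<And>n. N' \<subseteq> U n"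
      "\<And>n. emeasure coins (U n) < ennreal (1 / Suc n)"
    by metis
  let ?G = "\<Inter>n. U n"
  have Us: "U n \<in> sets coins" for n using U(1) sets_coins by simp
  have "emeasure coins ?G \<le> ennreal (1 / Suc n)" for n
  proof -
    have "emeasure coins ?G \<le> emeasure coins (U n)"
      using Us by (intro emeasure_mono) auto
    then show ?thesis using U(3)[of n] by simp
  qed
  moreover have "(\<lambda>n. ennreal (1 / Suc n)) \<longlonglongrightarrow> ennreal 0"
    by (intro tendsto_ennrealI) (use LIMSEQ_inverse_real_of_nat in \<open>simp add: inverse_eq_divide\<close>)
  ultimately have "emeasure coins ?G \<le> 0"
    using LIMSEQ_le_const[of _ "0::ennreal"] by fastforce
  moreover have "?G \<in> sets coins" using Us by auto
  ultimately have "?G \<in> null_sets coins" by auto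
  moreover have "gdelta_in euclidean ?G"
    using U(1) unfolding gdelta_in_euclidean by blast
  moreover have "N \<subseteq> ?G" using N' U(2) by blast
  ultimately show ?thesis using that by blast
qed

text \<open>A real codes a set of pairs \<open>(n, k)\<close>, read as: the basic open set
  \<open>b k\<close> is part of the \<open>n\<close>-th open set.\<close>

lemma gdelta_enumeration:
  "\<exists>e :: real \<Rightarrow> 'a::second_countable_topology set. range e = {G. gdelta_in euclidean G}"
proof -
  obtain f :: "real \<Rightarrow> nat set" where f: "surj f"
    using nat_sets_eqpoll_reals by (metis bij_betw_def eqpoll_def eqpoll_sym)
  obtain \<B> :: "'a set set" where B: "countable \<B>" "topological_basis \<B>"
    using ex_countable_basis by blast
  \<comment> \<open>The empty set is added to make the family nonempty, so that its enumeration is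
    onto.\<close>
  define b where "b = from_nat_into (insert {} \<B>)"
  have rb: "range b = insert {} \<B>"
    unfolding b_def using B(1) by (intro range_from_nat_into) auto
  have ob: "open (b k)" for k
    using rb B(2) topological_basis_open by (metis insert_iff open_empty rangeI)
  define e where "e r = (\<Inter>n. \<Union>k\<in>{k. prod_encode (n, k) \<in> f r}. b k)" for r
  have "gdelta_in euclidean (e r)" for r
    unfolding e_def gdelta_in_euclidean using ob
    by (intro exI[of _ "\<lambda>n. \<Union>k\<in>{k. prod_encode (n, k) \<in> f r}. b k"]) auto
  moreover have "\<exists>r. e r = G" if G: "gdelta_in euclidean G" for G
  proof -
    obtain C :: "nat \<Rightarrow> 'a set" where C: "\<forall>n. open (C n)" "G = (\<Inter>n. C n)"
      using G unfolding gdelta_in_euclidean by (elim exE conjE)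
    have "\<exists>S. C n = (\<Union>k\<in>S. b k)" for n
    proof -
      obtain \<B>' where B': "\<B>' \<subseteq> \<B>" "\<Union>\<B>' = C n"
        using B(2) C(1) unfolding topological_basis_def by metis
      have "b ` (b -` \<B>') = \<B>'"
        using B'(1) by (simp only: image_vimage_eq rb) blast
      then have "C n = (\<Union>k\<in>b -` \<B>'. b k)" using B'(2) by (simp only:)
      then show ?thesis ..
    qed
    then obtain S where S: "\<And>n. C n = (\<Union>k\<in>S n. b k)" by metis
    obtain r where r: "f r = {prod_encode (n, k) |n k. k \<in> S n}"
      using surjD[OF f, of "{prod_encode (n, k) |n k. k \<in> S n}"] by (elim exE) (rule that, rule sym)
    have "{k. prod_encode (n, k) \<in> f r} = S n" for n
      unfolding r by auto
    then have "e r = G" unfolding e_def C(2) by (simp add: S)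
    then show ?thesis ..
  qed
  ultimately show ?thesis by (intro exI[of _ e]) blast
qed

text \<open>A Sierpinski-type construction: the points are chosen along a well-order of the reals of
  minimal type, the one with index \<open>a\<close> inside the \<open>a\<close>-th \<open>G\<^sub>\<delta>\<close> set of the plane, with second
  coordinate outside the first \<open>a\<close> null sets. No choice depends on the previous ones.\<close>

lemma exists_generic_set:
  assumes cov: "|UNIV :: real set| \<le>o cov_null"
  obtains X :: "(cantor \<times> cantor) set"
  where "\<And>R B. gdelta_in euclidean R \<Longrightarrow> B \<in> sets coins \<Longrightarrow> emeasure coins B \<noteq> 0 \<Longrightarrow>
      B \<subseteq> snd ` R \<Longrightarrow> X \<inter> R \<noteq> {}"
    and "\<And>N. N \<in> null_sets cantor_measure \<Longrightarrow> |{p \<in> X. snd p \<in> N}| <o |UNIV :: real set|"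
proof -
  obtain e :: "real \<Rightarrow> (cantor \<times> cantor) set" where e: "range e = {G. gdelta_in euclidean G}"
    using gdelta_enumeration by blast
  obtain e' :: "real \<Rightarrow> cantor set" where e': "range e' = {G. gdelta_in euclidean G}"
    using gdelta_enumeration by blast
  \<comment> \<open>Indices of non-null sets receive the empty set, so that every \<open>N r\<close>
    is null and all null G-delta sets still occur.\<close>
  define N where "N r = (if e' r \<in> null_sets coins then e' r else {})" for r
  define r where "r = |UNIV :: real set|"
  have r: "Card_order r" "Field r = UNIV" "Well_order r"
    unfolding r_def by (rule card_of_Card_order Field_card_of card_of_Well_order)+
  have total: "(a, b) \<in> r \<or> (b, a) \<in> r" for a b
    using r(2,3) unfolding well_order_on_def linear_order_on_def partial_order_on_def
      preorder_on_def total_on_def refl_on_def by (metis UNIV_I)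
  have small: "|{b. (b, a) \<in> r}| <o |UNIV :: real set|" for a
  proof -
    \<comment> \<open>In a cardinal order the strict predecessors of \<open>a\<close> are few;
      \<open>a\<close> itself is added since the segment is not strict.\<close>
    have "|underS r a \<union> {a}| <o |UNIV :: real set|"
      by (rule card_of_Un_ordLess_infinite)
        (use card_of_underS[OF r(1), of a] r(2) in
          \<open>auto simp: r_def infinite_UNIV_char_0 intro: ordLess_real_if_countable\<close>)
    moreover have "{b. (b, a) \<in> r} \<subseteq> underS r a \<union> {a}" by (auto simp: underS_def)
    ultimately show ?thesis by (meson card_of_mono1 ordLeq_ordLess_trans)
  qed
  define good where "good a p \<longleftrightarrow> p \<in> e a \<and> (\<forall>b. (b, a) \<in> r \<longrightarrow> snd p \<notin> N b)" for a p
  define q where "q a = (SOME p. good a p)" for a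
  \<comment> \<open>Stages without a good point contribute nothing, so the arbitrary value of
    \<open>q\<close> there is harmless.\<close>
  define X where "X = {q a |a. \<exists>p. good a p}"
  have q: "good a (q a)" if "\<exists>p. good a p" for a
    unfolding q_def using that by (rule someI_ex)
  have Nnull: "N b \<in> null_sets cantor_measure" for b
    by (auto simp: N_def cantor_measure_def intro: null_sets_completionI)
  show ?thesis
  proof (rule that[of X])
    fix R :: "(cantor \<times> cantor) set" and B
    assume R: "gdelta_in euclidean R" and B: "B \<in> sets coins" "emeasure coins B \<noteq> 0" "B \<subseteq> snd ` R"
    obtain a where a: "e a = R" using e R by (metis mem_Collect_eq rangeE)
    have "\<not> B \<subseteq> \<Union>(N ` {b. (b, a) \<in> r})"
      using Nnull ordLeq_ordLess_trans[OF card_of_image small]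
      by (intro positive_measure_not_covered[OF cov B(1,2)]) auto
    then obtain y where y: "y \<in> B" "\<And>b. (b, a) \<in> r \<Longrightarrow> y \<notin> N b" by blast
    then obtain p where "p \<in> R" "snd p = y" using B(3) by blast
    then have "good a p" using y a by (auto simp: good_def)
    then have "\<exists>p. good a p" ..
    then have "q a \<in> X" "good a (q a)" using q by (auto simp: X_def)
    then show "X \<inter> R \<noteq> {}" using a by (auto simp: good_def)
  next
    fix M assume "M \<in> null_sets cantor_measure"
    then obtain G where G: "M \<subseteq> G" "gdelta_in euclidean G" "G \<in> null_sets coins"
      by (rule null_gdelta_superset)
    obtain b where "e' b = G" using e' G(2) by (metis mem_Collect_eq rangeE)
    then have b: "N b = G" using G(3) by (simp add: N_def)
    \<comment> \<open>A point chosen at stage \<open>b\<close> or later avoids \<open>N b\<close>,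
      which contains \<open>M\<close>.\<close>
    have "{p \<in> X. snd p \<in> M} \<subseteq> q ` {a. (a, b) \<in> r}"
    proof
      fix p assume p: "p \<in> {p \<in> X. snd p \<in> M}"
      then obtain a where a: "p = q a" "good a (q a)" using q by (auto simp: X_def)
      have "(b, a) \<notin> r" using a p b G(1) by (auto simp: good_def)
      then show "p \<in> q ` {a. (a, b) \<in> r}" using total a by blast
    qed
    then have "|{p \<in> X. snd p \<in> M}| \<le>o |q ` {a. (a, b) \<in> r}|" by (rule card_of_mono1)
    then show "|{p \<in> X. snd p \<in> M}| <o |UNIV :: real set|"
      using ordLeq_ordLess_trans[OF card_of_image small] by (rule ordLeq_ordLess_trans)
  qed
qed

subsection \<open>The Hurewicz property\<close>

lemma compact_UNIV_cantor: "compact (UNIV :: cantor set)"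
proof -
  have "compact_space (euclidean :: bool topology)"
    by (simp add: compact_space_def finite_imp_compact)
  then have "compact_space (product_topology (\<lambda>_::nat. euclidean :: bool topology) UNIV)"
    by (simp add: compact_space_product_topology)
  then show ?thesis
    by (simp add: compact_space_def euclidean_product_topology)
qed

lemma measure_coins_Compl: "A \<in> sets coins \<Longrightarrow> measure coins (- A) = 1 - measure coins A"
  unfolding Compl_eq_Diff_UNIV by (rule coins.P.prob_compl[unfolded space_coins])

lemma closed_imp_compact_plane: "closed S \<Longrightarrow> compact S" for S :: "(cantor \<times> cantor) set"
  using closed_Int_compact[OF _ compact_Times[OF compact_UNIV_cantor compact_UNIV_cantor], of S]
  by simp

lemma closed_imp_gdelta_in_euclidean:
  fixes C :: "'a::metric_space set"
  assumes "closed C" shows "gdelta_in euclidean C"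
  unfolding gdelta_in_euclidean
proof (intro exI conjI allI)
  let ?U = "\<lambda>n::nat. \<Union>y\<in>C. ball y (1 / Suc n)"
  show "open (?U n)" for n by blast
  show "C = (\<Inter>n. ?U n)"
  proof (intro equalityI subsetI)
    fix x assume x: "x \<in> (\<Inter>n. ?U n)"
    have "\<exists>y\<in>C. dist y x < e" if e: "e > 0" for e
    proof -
      obtain n :: nat where n: "1 / Suc n < e"
        by (rule nat_approx_posE[OF e])
      have "x \<in> (\<Union>y\<in>C. ball y (1 / Suc n))" using x by blast
      then obtain y where "y \<in> C" "dist y x < 1 / Suc n" by (elim UN_E) (simp only: mem_ball)
      then show ?thesis using n by (intro bexI[of _ y]) linarith+
    qed
    then show "x \<in> C" using closed_approachable[OF assms] by blast
  next
    fix x assume "x \<in> C"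
    then show "x \<in> (\<Inter>n. ?U n)" by (intro INT_I UN_I[of x]) simp_all
  qed
qed

text \<open>\<open>meets\<close> and \<open>small\<close> are the outcome of the construction;
  \<open>bounded\<close> says that the bounding number is at least the continuum.\<close>

locale generic_set =
  fixes X :: "(cantor \<times> cantor) set"
  assumes meets: "\<And>R B. gdelta_in euclidean R \<Longrightarrow> B \<in> sets coins \<Longrightarrow> emeasure coins B \<noteq> 0 \<Longrightarrow>
      B \<subseteq> snd ` R \<Longrightarrow> X \<inter> R \<noteq> {}"
    and small: "\<And>N. N \<in> null_sets cantor_measure \<Longrightarrow> |{p \<in> X. snd p \<in> N}| <o |UNIV :: real set|"
    and bounded: "\<And>F. |F| <o |UNIV :: real set| \<Longrightarrow> \<exists>g. \<forall>f\<in>F. f \<le>\<^sup>* g"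
begin

text \<open>The least indices for the points of \<open>Y\<close> form few functions, hence have a
  common bound; upward closure of \<open>Q\<close> does the rest. It serves both the covers and the
  distances below.\<close>

lemma bounded_by_least_index:
  assumes "|Y| <o |UNIV :: real set|" "\<And>y n. y \<in> Y \<Longrightarrow> \<exists>k. Q y n (k::nat)"
    and "\<And>y n j k. Q y n j \<Longrightarrow> j \<le> k \<Longrightarrow> Q y n k"
  obtains g where "\<And>y. y \<in> Y \<Longrightarrow> \<forall>\<^sub>F n in sequentially. Q y n (g n)"
proof -
  define f where "f y n = (LEAST k. Q y n k)" for y n
  have f: "Q y n (f y n)" if "y \<in> Y" for y n
    unfolding f_def using assms(2)[OF that] by (rule LeastI_ex)
  have "|f ` Y| <o |UNIV :: real set|"
    using card_of_image assms(1) by (rule ordLeq_ordLess_trans)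
  then obtain g where g: "\<forall>h\<in>f ` Y. h \<le>\<^sup>* g" using bounded by blast
  show ?thesis
  proof (rule that)
    fix y assume y: "y \<in> Y"
    then have "\<forall>\<^sub>F n in sequentially. f y n \<le> g n"
      using g by (simp add: eventually_dominated_def)
    then show "\<forall>\<^sub>F n in sequentially. Q y n (g n)"
      by (rule eventually_mono) (rule assms(3)[OF f[OF y]])
  qed
qed

text \<open>Compactness enters twice: closed sets have closed projections, and a horizontal line
  covered by the increasing \<open>W k\<close> lies in one of them.\<close>

lemma section_exhaustion:
  assumes W: "\<And>k. open (W k)" "incseq W" "X \<subseteq> (\<Union>k. W k)"
  shows "open {y. UNIV \<times> {y} \<subseteq> W k}"
    and "(\<lambda>k. measure coins {y. UNIV \<times> {y} \<subseteq> W k}) \<longlonglongrightarrow> 1"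
proof -
  let ?D = "\<lambda>k. {y. UNIV \<times> {y} \<subseteq> W k}"
  have closed_snd: "closed (snd ` S)" if "closed S" for S :: "(cantor \<times> cantor) set"
    using compact_continuous_image[OF continuous_on_snd[OF continuous_on_id] closed_imp_compact_plane[OF that]]
    by (rule compact_imp_closed)
  have D: "?D k = - snd ` (- W k)" for k
    by (rule set_eqI) (simp only: mem_Collect_eq Compl_iff snd_eq_Range Range_iff, blast)
  show open_D: "open (?D k)" for k
    unfolding D using closed_snd[of "- W k"] W(1) by (simp add: closed_def open_Compl)
  have D_sets: "?D k \<in> sets coins" for k
    using open_D sets_coins by simp
  let ?C = "- (\<Union>k. W k)"
  have C: "closed ?C" using W(1) by (intro closed_Compl open_UN) auto
  then have C': "snd ` ?C \<in> sets coins" using closed_snd sets_coins by simp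
  \<comment> \<open>Otherwise \<open>meets\<close> would put a point of \<open>X\<close> into the
    uncovered closed set.\<close>
  have "emeasure coins (snd ` ?C) = 0"
    using meets[OF closed_imp_gdelta_in_euclidean[OF C] C'] W(3) by blast
  then have null: "measure coins (snd ` ?C) = 0" by (simp add: measure_def)
  have "(\<Union>k. ?D k) = - snd ` ?C"
  proof (intro equalityI subsetI)
    fix y assume "y \<in> - snd ` ?C"
    then have "UNIV \<times> {y} \<subseteq> (\<Union>k. W k)"
      by (simp only: Compl_iff snd_eq_Range Range_iff) blast
    moreover have "compact ((UNIV :: cantor set) \<times> {y})"
      by (intro compact_Times compact_UNIV_cantor compact_sing)
    ultimately obtain K where K: "finite K" "UNIV \<times> {y} \<subseteq> (\<Union>k\<in>K. W k)"
      using W(1) by (metis compactE_image)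
    obtain m where "\<forall>k\<in>K. k \<le> m" using K(1) finite_nat_set_iff_bounded_le by blast
    then have "(\<Union>k\<in>K. W k) \<subseteq> W m" using incseqD[OF W(2)] by blast
    with K(2) have "UNIV \<times> {y} \<subseteq> W m" by (rule subset_trans)
    then show "y \<in> (\<Union>k. ?D k)" by (intro UN_I[of m] CollectI UNIV_I)
  next
    fix y assume "y \<in> (\<Union>k. ?D k)"
    then obtain k where k: "UNIV \<times> {y} \<subseteq> W k" by (elim UN_E CollectE)
    show "y \<in> - snd ` ?C"
      by (simp only: Compl_iff snd_eq_Range Range_iff) (use k in blast)
  qed
  moreover have "measure coins (- snd ` ?C) = 1"
    by (simp only: measure_coins_Compl[OF C'] null)
  moreover have "(\<lambda>k. measure coins (?D k)) \<longlonglongrightarrow> measure coins (\<Union>k. ?D k)"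
  proof (rule coins.P.finite_Lim_measure_incseq)
    show "range ?D \<subseteq> sets coins" using D_sets by blast
    show "incseq ?D" using W(2) unfolding incseq_def by blast
  qed
  ultimately show "(\<lambda>k. measure coins (?D k)) \<longlonglongrightarrow> 1" by (simp only:)
qed

text \<open>By Borel-Cantelli a suitable \<open>k\<close> works for almost every line. The points of
  \<open>X\<close> on exceptional lines are few and share a bound \<open>g\<close>; the maximum of
  \<open>g\<close> and \<open>k\<close> serves all points.\<close>

lemma eventually_in_increasing_covers:
  assumes W: "\<And>n k. open (W n k)" "\<And>n. incseq (W n)" "\<And>n. X \<subseteq> (\<Union>k. W n k)"
  obtains h where "\<And>x. x \<in> X \<Longrightarrow> \<forall>\<^sub>F n in sequentially. x \<in> W n (h n)"
proof -
  define D where "D n k = {y. UNIV \<times> {y} \<subseteq> W n k}" for n k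
  have D: "D n k \<in> sets coins" for n k
    using section_exhaustion(1)[OF W(1,2,3)] by (simp add: D_def sets_coins)
  have "\<exists>k. measure coins (- D n k) < (1/2) ^ n" for n
  proof -
    have "(\<lambda>k. measure coins (D n k)) \<longlonglongrightarrow> 1"
      unfolding D_def using section_exhaustion(2)[OF W(1,2,3)] .
    then have "\<forall>\<^sub>F k in sequentially. 1 - (1/2) ^ n < measure coins (D n k)"
      by (rule order_tendstoD) simp
    then obtain k where "1 - (1/2) ^ n < measure coins (D n k)"
      by (auto simp: eventually_sequentially)
    moreover have "measure coins (- D n k) = 1 - measure coins (D n k)"
      by (rule measure_coins_Compl[OF D])
    ultimately show ?thesis by (intro exI[of _ k]) simp
  qed
  then obtain k where k: "\<And>n. measure coins (- D n (k n)) < (1/2) ^ n" by metis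
  have "limsup (\<lambda>n. - D n (k n)) \<in> null_sets coins"
  proof (rule borel_cantelli_limsup1)
    show "summable (\<lambda>n. measure coins (- D n (k n)))"
      by (rule summable_comparison_test'[of "\<lambda>n. (1/2) ^ n" 0])
        (use k in \<open>auto intro: less_imp_le\<close>)
    show "- D n (k n) \<in> sets coins" for n
      using D sets_coins borel_comp by metis
  qed (simp add: coins.P.emeasure_eq_measure)
  then have "|{p \<in> X. snd p \<in> limsup (\<lambda>n. - D n (k n))}| <o |UNIV :: real set|"
    by (intro small) (simp add: cantor_measure_def null_sets_completionI)
  then obtain g where g: "\<And>x. x \<in> X \<Longrightarrow> snd x \<in> limsup (\<lambda>n. - D n (k n)) \<Longrightarrow>
      \<forall>\<^sub>F n in sequentially. x \<in> W n (g n)"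
  proof (rule bounded_by_least_index[where Q = "\<lambda>x n k. x \<in> W n k"])
    show "\<exists>k. x \<in> W n k" if "x \<in> {p \<in> X. snd p \<in> limsup (\<lambda>n. - D n (k n))}" for x n
      using that W(3)[of n] by blast
    show "x \<in> W n j" if "x \<in> W n i" "i \<le> j" for x n i j
      using that incseqD[OF W(2)] by blast
  qed blast
  show ?thesis
  proof (rule that)
    fix x assume x: "x \<in> X"
    have up: "x \<in> W n (max (g n) (k n))" if "x \<in> W n (g n) \<or> x \<in> W n (k n)" for n
      using that incseqD[OF W(2)[of n], of "g n" "max (g n) (k n)"]
        incseqD[OF W(2)[of n], of "k n" "max (g n) (k n)"] by auto
    have "\<forall>\<^sub>F n in sequentially. x \<in> W n (g n) \<or> x \<in> W n (k n)"
    proof (cases "snd x \<in> limsup (\<lambda>n. - D n (k n))")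
      case True
      show ?thesis using g[OF x True] by (rule eventually_mono) simp
    next
      case False
      then have "\<forall>\<^sub>F n in sequentially. snd x \<in> D n (k n)"
        by (auto simp: limsup_INF_SUP eventually_sequentially)
      then show ?thesis
        by (rule eventually_mono) (cases x, auto simp: D_def)
    qed
    then show "\<forall>\<^sub>F n in sequentially. x \<in> W n (max (g n) (k n))"
      by (rule eventually_mono) (rule up)
  qed
qed

text \<open>By the Lindelof property each cover becomes a sequence of traces of open sets of the
  plane, whose initial unions are increasing.\<close>

lemma Hurewicz: "Hurewicz X"
proof (cases "X = {}")
  case True
  then show ?thesis unfolding Hurewicz_def by (auto intro!: exI[of _ "\<lambda>_. {}"])
next
  case False
  show ?thesis
    unfolding Hurewicz_def
  proof (intro allI impI)
    fix \<U> :: "nat \<Rightarrow> (cantor \<times> cantor) set set"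
    assume \<U>: "\<forall>n. (\<forall>U\<in>\<U> n. openin (top_of_set X) U) \<and> \<Union>(\<U> n) = X"
    have "\<exists>V :: nat \<Rightarrow> _. (\<forall>k. open (V k) \<and> X \<inter> V k \<in> \<U> n) \<and> X \<subseteq> (\<Union>k. V k)" for n
    proof -
      define \<V> where "\<V> = {V. open V \<and> X \<inter> V \<in> \<U> n}"
      have "X \<subseteq> \<Union>\<V>"
      proof
        fix x assume "x \<in> X"
        then obtain U where U: "U \<in> \<U> n" "x \<in> U" using \<U> by blast
        then obtain V where "open V" "U = X \<inter> V" using \<U> by (meson openin_open)
        then show "x \<in> \<Union>\<V>" using U by (auto simp: \<V>_def)
      qed
      moreover obtain \<V>' where V': "\<V>' \<subseteq> \<V>" "countable \<V>'" "\<Union>\<V>' = \<Union>\<V>"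
        using Lindelof[of \<V>] by (auto simp: \<V>_def)
      ultimately have "X \<subseteq> \<Union>\<V>'" by simp
      moreover from this have ne: "\<V>' \<noteq> {}" using False by auto
      then have r: "range (from_nat_into \<V>') = \<V>'" using V'(2) by (rule range_from_nat_into)
      ultimately have "X \<subseteq> (\<Union>k. from_nat_into \<V>' k)" by simp
      moreover have "from_nat_into \<V>' k \<in> \<V>" for k
        using from_nat_into[OF ne] V'(1) by blast
      ultimately show ?thesis
        by (intro exI[of _ "from_nat_into \<V>'"]) (simp add: \<V>_def)
    qed
    then obtain V :: "nat \<Rightarrow> nat \<Rightarrow> (cantor \<times> cantor) set" where
      V: "\<And>n k. open (V n k)" "\<And>n k. X \<inter> V n k \<in> \<U> n" "\<And>n. X \<subseteq> (\<Union>k. V n k)"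
      by metis
    define W where "W n k = (\<Union>j\<le>k. V n j)" for n k
    obtain h where h: "\<And>x. x \<in> X \<Longrightarrow> \<forall>\<^sub>F n in sequentially. x \<in> W n (h n)"
    proof (rule eventually_in_increasing_covers[of W])
      show "open (W n k)" for n k unfolding W_def using V(1) by blast
      show "incseq (W n)" for n unfolding W_def by (force simp: incseq_def)
      show "X \<subseteq> (\<Union>k. W n k)" for n using V(3)[of n] unfolding W_def by blast
    qed blast
    \<comment> \<open>The index \<open>h n\<close> is included, matching \<open>j \<le> k\<close> in
      the definition of \<open>W\<close>.\<close>
    define \<F> where "\<F> n = (\<lambda>j. X \<inter> V n j) ` {..h n}" for n
    have "finite (- {n. x \<in> \<Union>(\<F> n)})" if "x \<in> X" for x
    proof -
      have "x \<in> \<Union>(\<F> n) \<longleftrightarrow> x \<in> W n (h n)" for n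
        using that by (auto simp: \<F>_def W_def)
      then show ?thesis
        using h[OF that] by (simp add: eventually_cofinite Compl_eq flip: cofinite_eq_sequentially)
    qed
    then show "\<exists>\<F>. (\<forall>n. finite (\<F> n) \<and> \<F> n \<subseteq> \<U> n) \<and> (\<forall>x\<in>X. finite (- {n. x \<in> \<Union>(\<F> n)}))"
      using V(2) by (intro exI[of _ \<F>]) (auto simp: \<F>_def)
  qed
qed

end

subsection \<open>The \<open>\<lambda>'\<close> property and perfect subsets\<close>

text \<open>Fixing the first \<open>n\<close> coordinates of the point gives a cylinder of measure
  \<open>(1/2) ^ n\<close>.\<close>

lemma coins_singleton_null: "{y} \<in> null_sets coins"
proof (rule null_setsI)
  show sets: "{y} \<in> sets coins" using sets_coins by simp
  have single: "measure coin {b} = 1 / 2" for b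
    by (cases b) (simp_all add: measure_pmf_single)
  have "measure coins {y} \<le> (1/2) ^ n" for n
  proof -
    have "measure coins {y} \<le> measure coins {x. \<forall>j\<in>{..<n}. x j \<in> {y j}}"
      by (intro coins.P.finite_measure_mono box_in_sets) auto
    also have "\<dots> = (\<Prod>j<n. measure coin {y j})"
      by (rule measure_coins_box) simp
    also have "\<dots> = (1/2) ^ n" by (simp only: single prod_constant card_lessThan)
    finally show ?thesis .
  qed
  moreover have "(\<lambda>n. (1/2 :: real) ^ n) \<longlonglongrightarrow> 0"
    by (rule LIMSEQ_realpow_zero) simp_all
  ultimately have "measure coins {y} \<le> 0"
    by (intro LIMSEQ_le_const[of _ 0]) auto
  then show "emeasure coins {y} = 0"
    by (simp add: coins.P.emeasure_eq_measure measure_le_0_iff)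
qed

lemma countable_null_cantor: "countable A \<Longrightarrow> A \<in> null_sets cantor_measure"
proof -
  assume "countable A"
  then have "(\<Union>y\<in>A. {y}) \<in> null_sets coins"
    by (rule null_sets_UN') (rule coins_singleton_null)
  then show ?thesis by (simp add: cantor_measure_def null_sets_completionI)
qed

context generic_set
begin

text \<open>Sets of fewer than \<open>\<bb>\<close> points are \<open>\<lambda>'\<close>: dominate the functions recording the
  distance of each point to the elements of the countable set.\<close>

lemma countable_gdelta_separation:
  fixes A Y :: "'a::metric_space set"
  assumes A: "countable A" "A \<noteq> {}" and Y: "|Y| <o |UNIV :: real set|"
  obtains H where "gdelta_in euclidean H" "A \<subseteq> H" "H \<inter> Y \<subseteq> A"
proof -
  define a where "a = from_nat_into A"
  have ra: "range a = A" unfolding a_def using A by (metis range_from_nat_into)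
  have "|Y - A| <o |UNIV :: real set|"
    by (rule ordLeq_ordLess_trans[OF card_of_mono1 Y]) (rule Diff_subset)
  then obtain g where g: "\<And>y. y \<in> Y - A \<Longrightarrow> \<forall>\<^sub>F n in sequentially. 1 / Suc (g n) \<le> dist (a n) y"
  proof (rule bounded_by_least_index[where Q = "\<lambda>y n k. 1 / Suc k \<le> dist (a n) y"])
    fix y n assume "y \<in> Y - A"
    then have "0 < dist (a n) y" using ra by auto
    then obtain k :: nat where "1 / Suc k < dist (a n) y" by (rule nat_approx_posE)
    then show "\<exists>k::nat. 1 / Suc k \<le> dist (a n) y" by (intro exI[of _ k]) simp
  next
    fix y n and j k :: nat assume j: "1 / Suc j \<le> dist (a n) y" "j \<le> k"
    have "1 / real (Suc k) \<le> 1 / Suc j" using j(2) by (intro divide_left_mono) auto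
    then show "1 / Suc k \<le> dist (a n) y" using j(1) by linarith
  qed blast
  \<comment> \<open>The shift \<open>m\<close> shrinks all balls at once: \<open>g\<close> already
    keeps \<open>y\<close> away from \<open>a n\<close> for large \<open>n\<close>, and a large
    \<open>m\<close> settles the finitely many other \<open>n\<close>.\<close>
  let ?H = "\<Inter>m. \<Union>n. ball (a n) (1 / Suc (g n + m))"
  show ?thesis
  proof (rule that)
    show "gdelta_in euclidean ?H"
      unfolding gdelta_in_euclidean
      by (intro exI[of _ "\<lambda>m. \<Union>n. ball (a n) (1 / Suc (g n + m))"] conjI allI refl) blast
    show "A \<subseteq> ?H"
    proof (intro subsetI INT_I)
      fix x m assume "x \<in> A"
      then obtain n where "x = a n" using ra by blast
      then show "x \<in> (\<Union>n. ball (a n) (1 / Suc (g n + m)))" by (intro UN_I[of n]) simp_all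
    qed
    show "?H \<inter> Y \<subseteq> A"
    proof (rule subsetI, rule ccontr)
      fix y assume y: "y \<in> ?H \<inter> Y" "y \<notin> A"
      then obtain n0 where n0: "\<And>n. n \<ge> n0 \<Longrightarrow> 1 / Suc (g n) \<le> dist (a n) y"
        using g[of y] by (auto simp: eventually_sequentially)
      have "\<exists>k::nat. 1 / Suc k \<le> dist (a n) y" for n
      proof -
        have "0 < dist (a n) y" using ra y(2) by auto
        then obtain k :: nat where "1 / Suc k < dist (a n) y" by (rule nat_approx_posE)
        then show ?thesis by (intro exI[of _ k]) simp
      qed
      then obtain k :: "nat \<Rightarrow> nat" where k: "\<And>n. 1 / Suc (k n) \<le> dist (a n) y" by metis
      define m where "m = (\<Sum>n<n0. k n)"
      have "1 / Suc (g n + m) \<le> dist (a n) y" for n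
      proof (cases "n < n0")
        case True
        then have "k n \<le> m" unfolding m_def by (intro member_le_sum) auto
        then have "1 / real (Suc (g n + m)) \<le> 1 / Suc (k n)" by (intro divide_left_mono) auto
        then show ?thesis using k[of n] by linarith
      next
        case False
        have "1 / real (Suc (g n + m)) \<le> 1 / Suc (g n)" by (intro divide_left_mono) auto
        then show ?thesis using n0[of n] False by linarith
      qed
      then have "y \<notin> (\<Union>n. ball (a n) (1 / Suc (g n + m)))"
        by (simp only: UN_iff mem_ball) (metis not_less)
      then show False using y(1) by blast
    qed
  qed
qed

lemma lambda': "lambda'_set X"
  unfolding lambda'_set_def
proof (intro allI impI)
  fix A :: "(cantor \<times> cantor) set" assume A: "countable A"
  show "gdelta_in (top_of_set (X \<union> A)) A"
  proof (cases "A = {}")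
    case False
    have "snd ` A \<in> null_sets cantor_measure"
      using A by (intro countable_null_cantor) simp
    then obtain G where G: "snd ` A \<subseteq> G" "gdelta_in euclidean G" "G \<in> null_sets coins"
      by (rule null_gdelta_superset)
    have "|{p \<in> X. snd p \<in> G}| <o |UNIV :: real set|"
      using G(3) by (intro small) (simp add: cantor_measure_def null_sets_completionI)
    then obtain H where H: "gdelta_in euclidean H" "A \<subseteq> H" "H \<inter> {p \<in> X. snd p \<in> G} \<subseteq> A"
      by (rule countable_gdelta_separation[OF A False])
    obtain C :: "nat \<Rightarrow> cantor set" where C: "\<forall>n. open (C n)" "G = (\<Inter>n. C n)"
      using G(2) unfolding gdelta_in_euclidean by (elim exE conjE)
    have vC: "open (snd -` C n :: (cantor \<times> cantor) set)" for n
      using C(1) by (simp add: open_vimage_snd)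
    have "(snd -` G :: (cantor \<times> cantor) set) = (\<Inter>n. snd -` C n)"
      unfolding C(2) by (rule vimage_INT)
    then have "gdelta_in euclidean (snd -` G :: (cantor \<times> cantor) set)"
      unfolding gdelta_in_euclidean using vC by (intro exI[of _ "\<lambda>n. snd -` C n"]) simp
    then have "gdelta_in euclidean (H \<inter> snd -` G)"
      using H(1) by (intro gdelta_in_Int)
    \<comment> \<open>A point of \<open>X\<close> outside \<open>A\<close> either does not lie over
      \<open>G\<close> or is excluded by \<open>H\<close>.\<close>
    moreover have "A = (H \<inter> snd -` G) \<inter> (X \<union> A)"
      using H(2,3) G(1) by blast
    ultimately show ?thesis unfolding gdelta_in_subtopology by blast
  qed simp
qed

text \<open>A vertical line is closed and projects onto the whole second factor, so \<open>X\<close>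
  meets it.\<close>

lemma fst_image: "fst ` X = UNIV"
proof -
  have "x \<in> fst ` X" for x
  proof -
    have "closed ({x} \<times> (UNIV :: cantor set))" by (intro closed_Times closed_UNIV closed_singleton)
    then have "X \<inter> {x} \<times> UNIV \<noteq> {}"
      using sets.top[of coins] coins.P.emeasure_space_1
      by (intro meets[of _ UNIV] closed_imp_gdelta_in_euclidean) (auto simp: space_coins)
    then show ?thesis by force
  qed
  then show ?thesis by blast
qed

end

section \<open>Baire category arguments\<close>

lemma open_cantor_not_singleton: "\<not> open {x :: cantor}"
proof
  assume "open {x}"
  then obtain B where B: "finite {n. B n \<noteq> UNIV}" "x \<in> Pi\<^sub>E UNIV B" "Pi\<^sub>E UNIV B \<subseteq> {x}"
    unfolding open_fun_def using product_topology_open_contains_basis[of "\<lambda>_. euclidean" UNIV "{x}" x]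
    by auto
  \<comment> \<open>A basic box restricts finitely many coordinates, so some coordinate
    \<open>n\<close> can be changed freely.\<close>
  obtain n where n: "n \<notin> {n. B n \<noteq> UNIV}"
    using ex_new_if_finite[OF infinite_UNIV_nat B(1)] by blast
  have "(x(n := \<not> x n)) i \<in> B i" for i
    using n B(2) by (cases "i = n") auto
  then have "x(n := \<not> x n) \<in> {x}" using B(3) by blast
  then have "(x(n := \<not> x n)) n = x n" by (metis singletonD)
  then show False unfolding fun_upd_same by blast
qed

lemma closure_eq_UNIV_if_meets_open:
  assumes "\<And>U. open U \<Longrightarrow> U \<noteq> {} \<Longrightarrow> U \<inter> D \<noteq> {}"
  shows "closure D = UNIV"
proof (rule ccontr)
  assume "closure D \<noteq> UNIV"
  then have "- closure D \<noteq> {}" by blast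
  then have "- closure D \<inter> D \<noteq> {}" by (intro assms open_Compl closed_closure)
  then show False using closure_subset[of D] by blast
qed

text \<open>The open sets defining \<open>D\<close> and the complements of its points would be
  countably many dense open sets with empty intersection.\<close>

lemma countable_dense_not_gdelta:
  fixes D :: "cantor set"
  assumes "countable D" "closure D = UNIV"
  shows "\<not> gdelta_in euclidean D"
proof
  assume "gdelta_in euclidean D"
  then obtain C :: "nat \<Rightarrow> cantor set" where C: "\<forall>n. open (C n)" "D = (\<Inter>n. C n)"
    unfolding gdelta_in_euclidean by (elim exE conjE)
  let ?G = "range C \<union> (\<lambda>d. - {d}) ` D"
  have "euclidean closure_of \<Inter>?G = topspace (euclidean :: cantor topology)"
  proof (rule Baire_category)
    show "countable ?G" using assms(1) by simp
    fix T assume "T \<in> ?G"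
    then show "openin euclidean T \<and> euclidean closure_of T = topspace euclidean"
    proof (elim UnE imageE)
      fix n assume T: "T = C n"
      have "D \<subseteq> C n" using C(2) by blast
      then have "closure (C n) = UNIV" using assms(2) closure_mono by blast
      then show ?thesis using C(1) T by simp
    next
      fix d assume T: "T = - {d}"
      have "closure (- {d}) = UNIV"
      proof (rule closure_eq_UNIV_if_meets_open)
        fix U :: "cantor set" assume "open U" "U \<noteq> {}"
        then show "U \<inter> - {d} \<noteq> {}"
          using open_cantor_not_singleton[of d] by (metis Diff_eq Diff_eq_empty_iff subset_singletonD)
      qed
      then show ?thesis using T by (simp add: open_Compl)
    qed
  qed (simp add: completely_metrizable_space_euclidean)
  moreover have "\<Inter>?G = {}" using C(2) by blast
  ultimately have "(UNIV :: cantor set) = {}" by (metis closure_of_empty topspace_euclidean)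
  then show False by (metis UNIV_not_empty)
qed

text \<open>A homeomorphism onto a perfect subset of \<open>X\<close> carries a countable dense set
  to a relative G-delta; pulling back makes the dense set itself G-delta.\<close>

lemma lambda'_set_imp_totally_imperfect:
  assumes X: "lambda'_set X" shows "totally_imperfect X"
  unfolding totally_imperfect_def perfect_set_def
proof
  assume "\<exists>P\<subseteq>X. P homeomorphic (UNIV :: cantor set)"
  then obtain P and f :: "cantor \<Rightarrow> 'a" and g where P: "P \<subseteq> X" "homeomorphism UNIV P f g"
    unfolding homeomorphic_def by (meson homeomorphism_symD)
  obtain D :: "cantor set" where D: "countable D" "\<And>U. open U \<Longrightarrow> U \<noteq> {} \<Longrightarrow> \<exists>d\<in>D. d \<in> U"
    using countable_dense_exists[where 'a = cantor] by blast
  have fD: "f ` D \<subseteq> P" using P(2) by (auto simp: homeomorphism_def)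
  then have "X \<union> f ` D = X" using P(1) by blast
  then have "gdelta_in (top_of_set X) (f ` D)"
    using X D(1) unfolding lambda'_set_def by (metis countable_image)
  then obtain T where T: "gdelta_in euclidean T" "f ` D = T \<inter> X"
    unfolding gdelta_in_subtopology by blast
  obtain C :: "nat \<Rightarrow> 'a set" where C: "\<forall>n. open (C n)" "T = (\<Inter>n. C n)"
    using T(1) unfolding gdelta_in_euclidean by (elim exE conjE)
  have f: "continuous_on UNIV f" "\<And>x. f x \<in> P" "\<And>x. g (f x) = x"
    using P(2) by (auto simp: homeomorphism_def)
  have "D = f -` T"
  proof (intro equalityI subsetI)
    fix x assume "x \<in> D" then show "x \<in> f -` T" using T(2) by blast
  next
    fix x assume "x \<in> f -` T"
    then have "f x \<in> f ` D" using T(2) f(2) P(1) by blast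
    then obtain d where "d \<in> D" "f x = f d" by blast
    then show "x \<in> D" using f(3) by metis
  qed
  also have "\<dots> = (\<Inter>n. f -` C n)" unfolding C(2) by (rule vimage_INT)
  finally have "gdelta_in euclidean D"
    unfolding gdelta_in_euclidean using C(1) f(1)
    by (intro exI[of _ "\<lambda>n. f -` C n"]) (simp add: open_vimage)
  moreover have "closure D = UNIV"
    by (rule closure_eq_UNIV_if_meets_open) (use D(2) in blast)
  ultimately show False using countable_dense_not_gdelta[OF D(1)] by blast
qed

text \<open>By Baire, the closures of the nowhere dense pieces have a union with empty interior, yet
  \<open>Q\<close> is open in itself.\<close>

lemma compact_not_meager_in_itself:
  fixes Q :: "'a::metric_space set"
  assumes "compact Q" "Q \<noteq> {}" shows "\<not> meager_in (top_of_set Q) Q"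
proof
  assume "meager_in (top_of_set Q) Q"
  then obtain \<N> where N: "countable \<N>" "\<And>N. N \<in> \<N> \<Longrightarrow> nowhere_dense_in (top_of_set Q) N"
      "\<Union>\<N> = Q"
    unfolding meager_in_def union_of_def by blast
  let ?G = "(closure_of) (top_of_set Q) ` \<N>"
  have cpt: "compact_space (top_of_set Q)"
    using assms(1) by (simp add: compact_space_subtopology)
  moreover have "Hausdorff_space (top_of_set Q)"
    by (intro Hausdorff_space_subtopology Hausdorff_space_euclidean)
  ultimately have "locally_compact_space (top_of_set Q) \<and> regular_space (top_of_set Q)"
    by (simp add: compact_imp_locally_compact_space compact_Hausdorff_imp_regular_space)
  then have "top_of_set Q interior_of \<Union>?G = {}"
    using N(1,2) by (intro Baire_category_alt) (auto simp: nowhere_dense_in_def)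
  moreover have "\<Union>?G = Q"
  proof
    show "\<Union>?G \<subseteq> Q" using closure_of_subset_topspace[of "top_of_set Q"] by auto
    show "Q \<subseteq> \<Union>?G"
    proof
      fix x assume "x \<in> Q"
      then obtain N where "N \<in> \<N>" "x \<in> N" using N(3) by blast
      moreover have "N \<subseteq> top_of_set Q closure_of N"
        by (rule closure_of_subset) (use N(3) \<open>N \<in> \<N>\<close> in auto)
      ultimately show "x \<in> \<Union>?G" by blast
    qed
  qed
  ultimately have "top_of_set Q interior_of Q = {}" by simp
  moreover have "top_of_set Q interior_of Q = Q"
    using interior_of_topspace[of "top_of_set Q"] by simp
  ultimately show False using assms(2) by simp
qed

subsection \<open>Transitive perfect meagerness\<close>

definition interleave :: "cantor \<times> cantor \<Rightarrow> cantor" where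
  "interleave p n = (if even n then fst p (n div 2) else snd p (n div 2))"

definition deinterleave :: "cantor \<Rightarrow> cantor \<times> cantor" where
  "deinterleave z = (\<lambda>n. z (2 * n), \<lambda>n. z (Suc (2 * n)))"

lemma deinterleave_interleave [simp]: "deinterleave (interleave p) = p"
  by (cases p) (simp add: deinterleave_def interleave_def)

lemma continuous_on_interleave: "continuous_on UNIV interleave"
proof -
  have "continuous_on UNIV (\<lambda>p::cantor \<times> cantor. fst p m)"
    and "continuous_on UNIV (\<lambda>p::cantor \<times> cantor. snd p m)" for m
    by (rule continuous_on_compose2[where g = "\<lambda>x. x m" and t = UNIV],
        intro continuous_on_product_coordinates, intro continuous_intros, simp)+
  then have "continuous_on UNIV (\<lambda>p. interleave p n)" for n
    unfolding interleave_def by (cases "even n") simp_all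
  then show ?thesis
    by (intro continuous_on_coordinatewise_then_product) simp
qed

lemma continuous_on_deinterleave: "continuous_on UNIV deinterleave"
  unfolding deinterleave_def
  by (intro continuous_on_Pair continuous_on_coordinatewise_then_product
      continuous_on_product_coordinates)

lemma homeomorphism_interleave: "homeomorphism S (interleave ` S) interleave deinterleave"
  unfolding homeomorphism_def
  by (auto simp: image_image intro: continuous_on_subset[OF continuous_on_interleave]
      continuous_on_subset[OF continuous_on_deinterleave])

text \<open>The reason for this particular homeomorphism: the line at height \<open>y\<close>
  becomes a translate of the line at height zero.\<close>

lemma oplus_interleave:
  "interleave (\<lambda>_. False, y) \<oplus>\<^sub>2 interleave (x, \<lambda>_. False) = interleave (x, y)"
  by (rule ext) (simp add: oplus_def interleave_def)

context generic_set
begin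

text \<open>A translate of \<open>P\<close> is compact, so \<open>F\<close>, being meager in it,
  cannot contain it. Hence the pulled-back complement \<open>R\<close> of \<open>F\<close>, a
  G-delta set, meets every horizontal line, and \<open>X\<close> meets \<open>R\<close>.\<close>

lemma not_PMT_interleave: "\<not> PMT (interleave ` X)"
proof
  assume PMT: "PMT (interleave ` X)"
  define P where "P = interleave ` (UNIV \<times> {\<lambda>_. False})"
  have "(UNIV \<times> {\<lambda>_. False} :: (cantor \<times> cantor) set) homeomorphic (UNIV :: cantor set)"
    unfolding homeomorphic_def homeomorphism_def
    by (intro exI[of _ fst] exI[of _ "\<lambda>x. (x, \<lambda>_. False)"])
      (auto intro!: continuous_on_fst continuous_on_Pair continuous_on_id continuous_on_const)
  then have "perfect_set P"
    unfolding perfect_set_def P_def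
    by (metis homeomorphic_def homeomorphic_sym homeomorphic_trans homeomorphism_interleave)
  then obtain F where F: "sigma_compact F" "interleave ` X \<subseteq> F"
      "\<And>t. meager_in (top_of_set ((\<oplus>\<^sub>2) t ` P)) (F \<inter> (\<oplus>\<^sub>2) t ` P)"
    using PMT unfolding PMT_def by meson
  obtain \<K> where K: "countable \<K>" "\<And>K. K \<in> \<K> \<Longrightarrow> compact K" "\<Union>\<K> = F"
    using F(1) unfolding sigma_compact_def union_of_def by blast
  define K where "K = from_nat_into (insert {} \<K>)"
  have rK: "range K = insert {} \<K>"
    unfolding K_def using K(1) by (intro range_from_nat_into) auto
  have openK: "open (interleave -` (- K n))" for n
  proof -
    have "K n \<in> insert {} \<K>" using rK by blast
    then have "closed (K n)" by (metis K(2) compact_imp_closed closed_empty insertE)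
    then show ?thesis using continuous_on_interleave by (intro open_vimage open_Compl)
  qed
  define R where "R = (\<Inter>n. interleave -` (- K n))"
  have R: "gdelta_in euclidean R"
    unfolding gdelta_in_euclidean R_def
    by (intro exI[of _ "\<lambda>n. interleave -` (- K n)"] conjI allI openK refl)
  have R_iff: "p \<in> R \<longleftrightarrow> interleave p \<notin> F" for p
  proof -
    have "F = (\<Union>n. K n)" unfolding rK Union_insert K(3) by blast
    then show ?thesis unfolding R_def by blast
  qed
  have "y \<in> snd ` R" for y
  proof -
    define Q where "Q = interleave ` (UNIV \<times> {y})"
    have "(\<oplus>\<^sub>2) (interleave (\<lambda>_. False, y)) ` P = (\<lambda>x. interleave (x, y)) ` UNIV"
      unfolding P_def by (auto simp: image_image oplus_interleave image_iff)
    also have "\<dots> = Q" unfolding Q_def by auto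
    finally have "meager_in (top_of_set Q) (F \<inter> Q)"
      using F(3) by metis
    moreover have "compact Q"
      unfolding Q_def
      by (intro compact_continuous_image continuous_on_subset[OF continuous_on_interleave]
          compact_Times compact_UNIV_cantor compact_sing) simp
    moreover have "Q \<noteq> {}" by (auto simp: Q_def)
    ultimately have "F \<inter> Q \<noteq> Q" using compact_not_meager_in_itself by metis
    then obtain x where "interleave (x, y) \<notin> F" by (auto simp: Q_def)
    then have "(x, y) \<in> R" by (simp add: R_iff)
    then show ?thesis by (rule image_eqI[rotated]) simp
  qed
  then have "X \<inter> R \<noteq> {}"
    using sets.top[of coins] coins.P.emeasure_space_1
    by (intro meets[of _ UNIV] R) (auto simp: space_coins)
  then show False using F(2) R_iff by blast
qed

end

theorem theorem2p1:
  assumes "cov_null =o bounding_number" and "bounding_number =o continuum"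
  shows "\<exists>X :: (cantor \<times> cantor) set.
    Hurewicz X \<and>
    lambda'_set X \<and>
    totally_imperfect X \<and>
    fst ` X = UNIV \<and>
    (\<exists>Y :: cantor set. X homeomorphic Y \<and> \<not> PMT Y)"
proof -
  have b: "|UNIV :: real set| \<le>o bounding_number"
    by (rule ordIso_imp_ordLeq[OF ordIso_symmetric[OF assms(2)[unfolded continuum_def]]])
  then have "|UNIV :: real set| \<le>o cov_null"
    using assms(1) by (rule ordLeq_ordIso_trans[OF _ ordIso_symmetric])
  then obtain X :: "(cantor \<times> cantor) set"
    where X: "\<And>R B. gdelta_in euclidean R \<Longrightarrow> B \<in> sets coins \<Longrightarrow> emeasure coins B \<noteq> 0 \<Longrightarrow>
      B \<subseteq> snd ` R \<Longrightarrow> X \<inter> R \<noteq> {}"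
    "\<And>N. N \<in> null_sets cantor_measure \<Longrightarrow> |{p \<in> X. snd p \<in> N}| <o |UNIV :: real set|"
    by (rule exists_generic_set) blast
  \<comment> \<open>Only \<open>bounded\<close> is left: by minimality of
    \<open>bounding_number\<close>, an unbounded family has at least continuum many members.\<close>
  interpret generic_set X
  proof
    fix F :: "(nat \<Rightarrow> nat) set" assume F: "|F| <o |UNIV :: real set|"
    show "\<exists>g. \<forall>f\<in>F. f \<le>\<^sup>* g"
    proof (rule ccontr)
      assume "\<not> (\<exists>g. \<forall>f\<in>F. f \<le>\<^sup>* g)"
      then have "unbounded F" by (simp add: unbounded_def)
      then have "bounding_number \<le>o |F|"
        unfolding bounding_number_def by (intro min_card(2))
      with b have "|UNIV :: real set| \<le>o |F|" by (rule ordLeq_transitive)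
      then show False using F not_ordLess_ordLeq by blast
    qed
  qed (fact X)+
  show ?thesis
  proof (intro exI conjI)
    show "X homeomorphic interleave ` X"
      unfolding homeomorphic_def using homeomorphism_interleave by blast
  qed (fact Hurewicz lambda' lambda'_set_imp_totally_imperfect[OF lambda'] fst_image
      not_PMT_interleave)+
qed

end
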